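(* Let $\mathcal S$ be a sequent calculus as described in the context, containing the rule $(\lor L)$: from $\Gamma,A\vdash C$ and $\Gamma,B\vdash C$ infer $\Gamma,A\lor B\vdash C$. Let $A,B$ be formulae, let $\vec D$ be a context (finite list of formulae) and, for every formula $C$, let $\mathcal S_{\vec D,C}:(\vec D,A\vdash C;\ \vec D,B\vdash C)\longrightarrow(\vec D,A\lor B\vdash C)$ be the multi-arrow of $\mathsf{MultiSequents}_{\mathcal S}$ given by the derivation consisting of the single instance of $(\lor L)$ with premises the extra axioms $\vec D,A\vdash C$ and $\vec D,B\vdash C$. Then for all formulae $E,F$ and every derivation $\Pi$ of $E\vdash F$, the equation $$\Phi_{A\lor B}(\vec D,\Pi)\circ\mathcal S_{\vec D,E}\;=\;\mathcal S_{\vec D,F}\circ\bigl(\Phi_A(\vec D,\Pi),\ \Phi_B(\vec D,\Pi)\bigr)$$ between multi-arrows $(\vec D,A\vdash E;\ \vec D,B\vdash E)\longrightarrow(\vec D,A\lor B\vdash F)$ holds in the quotient multicategory $\mathsf{MultiSequents}_{\mathcal S}/{\equiv^{\mathrm{perm}}}$. Thus the family $\mathcal S_{\vec D,\_}:\Phi_A(\vec D,\_),\Phi_B(\vec D,\_)\Rightarrow\Phi_{A\lor B}(\vec D,\_)$ is a natural transformation.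
   Context: **System.** $\mathcal S$ is a sequent calculus whose sequents $\vec A\vdash A$ consist of a finite list of formulae (context) $\vec A$ and one formula $A$. It includes the structural rules of exchange, weakening and contraction, the axiom rule $A\vdash A$ and the cut rule, and it comes with a cut-elimination procedure by which every derivation can be transformed into a normal (cut-free) one in finitely many steps. $\equiv^{\mathrm{cut}}$ is the smallest equivalence relation on derivations containing the cut-elimination conversions. Applications of exchange are left implicit. **Category of formulae.** $\mathsf{Formulae}_{\mathcal S}$ has formulae as objects; an arrow from $E$ to $F$ is a derivation $\Pi$ of $E\vdash F$, equality of arrows being $\equiv^{\mathrm{cut}}$; identities are axioms and composition is cut. **Multicategory of sequents.** $\mathsf{MultiSequents}_{\mathcal S}$ has sequents as objects. A multi-arrow $(\vec A_1\vdash A_1;\dots;\vec A_n\vdash A_n)\to(\vec B\vdash B)$ is a derivation of $\vec B\vdash B$ which may use the sequents $\vec A_i\vdash A_i$ as extra axioms; equality of multi-arrows is $\equiv^{\mathrm{cut}}$. The identity on $\vec A\vdash A$ is the derivation consisting only of the extra axiom $\vec A\vdash A$. Composition replaces the occurrences of extra axioms by derivations of the corresponding sequents. **Free permutations.** Two consecutive occurrences of rules in a derivation are freely permutable when the derivation obtained by switching their order is correct and has the same conclusion (the switch may duplicate one of the two rules together with the sub-derivations above it; for example, moving a rule acting on the conclusion $C$ from below $(\lor L)$ to above it applies that rule, with the sub-derivations of its other premises, in both branches). $\equiv^{\mathrm{perm}}$ is the family of smallest equivalence relations, on derivations with the same extra axioms and the same conclusion, closed under $\equiv^{\mathrm{cut}}$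 and under free permutations of rules. It is a congruence for composition, and $\mathsf{MultiSequents}_{\mathcal S}/{\equiv^{\mathrm{perm}}}$ is the corresponding quotient multicategory. **Functors.** For $X\in\{A,\ B,\ A\lor B\}$, the functor $\Phi_X(\vec D,\_):\mathsf{Formulae}_{\mathcal S}\to\mathsf{MultiSequents}_{\mathcal S}/{\equiv^{\mathrm{perm}}}$ sends a formula $C$ to the sequent $\vec D,X\vdash C$, and sends a derivation $\Pi$ of $E\vdash F$ to the unary arrow $\Phi_X(\vec D,\Pi):(\vec D,X\vdash E)\to(\vec D,X\vdash F)$ given by the derivation that cuts the extra axiom $\vec D,X\vdash E$ with $\Pi$ on $E$. **Natural transformations into a multicategory.** For a category $\mathcal C$, a multicategory $\mathcal M$ and functors $F_1,\dots,F_n,G:\mathcal C\to\mathcal M$ (sending arrows to unary multi-arrows), a natural transformation $\theta:F_1,\dots,F_n\Rightarrow G$ is a family of multi-arrows $\theta_X:F_1(X),\dots,F_n(X)\to G(X)$ with $\theta_Y\circ(F_1(f),\dots,F_n(f))=G(f)\circ\theta_X$ for every $f:X\to Y$ in $\mathcal C$. *)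

theory Defs
  imports Main
begin

section \<open>Sequents and schematic rules\<close>

type_synonym 'f sequent = "'f list \<times> 'f"

text \<open>
  A rule is a figure built from context variables \<open>Ctx k\<close>, each standing for a list of formulae,
  and explicitly displayed formulae. A pattern with succedent \<open>None\<close> has the passive succedent,
  i.e. the succedent of the conclusion of the inference.

  Everything in this section is polymorphic in \<open>'a\<close>: it is used both for formulae and for named
  occurrences of formulae (pairs of a formula and a name).
\<close>

datatype 'a item = Ctx nat | Fml 'a

type_synonym 'a pattern = "'a item list \<times> 'a option"

datatype 'a schema =
  Schema (prems: "('a item list \<times> 'a option) list") (concl: "'a item list \<times> 'a option")

definition ctx_vars :: "'a schema \<Rightarrow> nat set" where
  "ctx_vars r = {k. \<exists>p \<in> set (concl r # prems r). Ctx k \<in> set (fst p)}"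

definition displayed :: "'a schema \<Rightarrow> 'a list" where
  "displayed r = concat (map (\<lambda>(is, s).
     concat (map (\<lambda>x. case x of Ctx k \<Rightarrow> [] | Fml a \<Rightarrow> [a]) is)
     @ (case s of None \<Rightarrow> [] | Some a \<Rightarrow> [a])) (concl r # prems r))"

definition fill :: "'a list list \<Rightarrow> 'a \<Rightarrow> 'a pattern \<Rightarrow> 'a sequent" where
  "fill \<Gamma>s c p =
     (concat (map (\<lambda>x. case x of Ctx k \<Rightarrow> \<Gamma>s ! k | Fml a \<Rightarrow> [a]) (fst p)),
      case snd p of None \<Rightarrow> c | Some a \<Rightarrow> a)"

definition instance_of ::
    "'a schema \<Rightarrow> 'a list list \<Rightarrow> 'a sequent list \<Rightarrow> 'a sequent \<Rightarrow> bool" where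
  "instance_of r \<Gamma>s ps c \<longleftrightarrow>
     ctx_vars r = {..<length \<Gamma>s} \<and>
     ps = map (fill \<Gamma>s (snd c)) (prems r) \<and>
     c = fill \<Gamma>s (snd c) (concl r)"


section \<open>Sequent calculi and derivations\<close>

text \<open>
  The rules of a calculus are the structural rules, axiom, cut, \<open>(\<or>L)\<close>, and arbitrary further
  rules indexed by \<open>'r\<close>.
\<close>

datatype ('f, 'r) rule =
  Ax 'f | Cut 'f | Weak 'f | Contr 'f | Exch | OrL 'f 'f | Other 'r

text \<open>
  Derivations with extra axioms: \<open>Hyp i\<close> is a use of the \<open>i\<close>-th extra axiom;
  \<open>Infer R \<Gamma>s C ds\<close> is an inference by \<open>R\<close> with contexts \<open>\<Gamma>s\<close>, succedent \<open>C\<close> in its conclusion,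
  and immediate subderivations \<open>ds\<close>.
\<close>

datatype ('f, 'r) deriv =
  Hyp nat | Infer "('f, 'r) rule" "'f list list" 'f "('f, 'r) deriv list"

text \<open>
  \<open>schm\<close> and \<open>side\<close> give the shape of the further rules and their side conditions (such as
  eigenvariable conditions, or restrictions on contexts); \<open>conv\<close> is the set of cut-elimination
  conversions, as redex/contractum pairs.
\<close>

record ('f, 'r) calculus =
  lor :: "'f \<Rightarrow> 'f \<Rightarrow> 'f"
  schm :: "'r \<Rightarrow> 'f schema"
  side :: "'r \<Rightarrow> 'f list list \<Rightarrow> 'f \<Rightarrow> bool"
  conv :: "('f, 'r) deriv \<Rightarrow> ('f, 'r) deriv \<Rightarrow> bool"

text \<open>
  So that exchanges can be left implicit, rules act at any position of the context; \<open>(\<or>L)\<close> with its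
  active formulae at the end of the context is the case where \<open>Ctx 1\<close> is empty. The exchange rule
  swaps two adjacent blocks and displays no formula, so it acts on no formula occurrence.
\<close>

fun rule_schema :: "('f, 'r) calculus \<Rightarrow> ('f, 'r) rule \<Rightarrow> 'f schema" where
  "rule_schema S (Ax A) = Schema [] ([Fml A], Some A)"
| "rule_schema S (Cut A) =
     Schema [([Ctx 0], Some A), ([Ctx 1, Fml A, Ctx 2], None)] ([Ctx 1, Ctx 0, Ctx 2], None)"
| "rule_schema S (Weak A) = Schema [([Ctx 0, Ctx 1], None)] ([Ctx 0, Fml A, Ctx 1], None)"
| "rule_schema S (Contr A) =
     Schema [([Ctx 0, Fml A, Fml A, Ctx 1], None)] ([Ctx 0, Fml A, Ctx 1], None)"
| "rule_schema S Exch =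
     Schema [([Ctx 0, Ctx 1, Ctx 2, Ctx 3], None)] ([Ctx 0, Ctx 2, Ctx 1, Ctx 3], None)"
| "rule_schema S (OrL A B) =
     Schema [([Ctx 0, Fml A, Ctx 1], None), ([Ctx 0, Fml B, Ctx 1], None)]
       ([Ctx 0, Fml (lor S A B), Ctx 1], None)"
| "rule_schema S (Other r) = schm S r"

fun side_cond :: "('f, 'r) calculus \<Rightarrow> ('f, 'r) rule \<Rightarrow> 'f list list \<Rightarrow> 'f \<Rightarrow> bool" where
  "side_cond S (Other r) \<Gamma>s C = side S r \<Gamma>s C"
| "side_cond S _ \<Gamma>s C = True"

text \<open>\<open>derives S Hs d s\<close>: \<open>d\<close> is a correct derivation of \<open>s\<close> with extra axioms \<open>Hs\<close>.\<close>

inductive derives ::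
    "('f, 'r) calculus \<Rightarrow> 'f sequent list \<Rightarrow> ('f, 'r) deriv \<Rightarrow> 'f sequent \<Rightarrow> bool"
  for S :: "('f, 'r) calculus" and Hs :: "'f sequent list" where
  hyp: "i < length Hs \<Longrightarrow> derives S Hs (Hyp i) (Hs ! i)"
| inf: "instance_of (rule_schema S R) \<Gamma>s ps c \<Longrightarrow> side_cond S R \<Gamma>s (snd c) \<Longrightarrow>
        list_all2 (derives S Hs) ds ps \<Longrightarrow> derives S Hs (Infer R \<Gamma>s (snd c) ds) c"

fun cut_free :: "('f, 'r) deriv \<Rightarrow> bool" where
  "cut_free (Hyp i) \<longleftrightarrow> True"
| "cut_free (Infer R \<Gamma>s C ds) \<longleftrightarrow> (\<forall>A. R \<noteq> Cut A) \<and> (\<forall>d \<in> set ds. cut_free d)"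

fun subst :: "(nat \<Rightarrow> ('f, 'r) deriv) \<Rightarrow> ('f, 'r) deriv \<Rightarrow> ('f, 'r) deriv" where
  "subst \<sigma> (Hyp i) = \<sigma> i"
| "subst \<sigma> (Infer R \<Gamma>s C ds) = Infer R \<Gamma>s C (map (subst \<sigma>) ds)"

inductive at_sub ::
    "(('f, 'r) deriv \<Rightarrow> ('f, 'r) deriv \<Rightarrow> bool) \<Rightarrow> ('f, 'r) deriv \<Rightarrow> ('f, 'r) deriv \<Rightarrow> bool"
  for T :: "('f, 'r) deriv \<Rightarrow> ('f, 'r) deriv \<Rightarrow> bool" where
  root: "T d e \<Longrightarrow> at_sub T d e"
| sub: "i < length ds \<Longrightarrow> at_sub T (ds ! i) e \<Longrightarrow>
        at_sub T (Infer R \<Gamma>s C ds) (Infer R \<Gamma>s C (ds[i := e]))"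

text \<open>The axiom \<open>A \<turnstile> A\<close>, and the cut of \<open>\<Gamma> \<turnstile> E\<close> with \<open>E \<turnstile> F\<close>.\<close>

definition axiom :: "'f \<Rightarrow> ('f, 'r) deriv" where
  "axiom A = Infer (Ax A) [] A []"

definition cut_deriv ::
    "'f list \<Rightarrow> 'f \<Rightarrow> 'f \<Rightarrow> ('f, 'r) deriv \<Rightarrow> ('f, 'r) deriv \<Rightarrow> ('f, 'r) deriv" where
  "cut_deriv \<Gamma> E F d e = Infer (Cut E) [\<Gamma>, [], []] F [d, e]"


section \<open>Equalities of derivations\<close>

definition eq_closure ::
    "('f, 'r) calculus \<Rightarrow> (('f, 'r) deriv \<Rightarrow> ('f, 'r) deriv \<Rightarrow> bool) \<Rightarrow>
     'f sequent list \<Rightarrow> 'f sequent \<Rightarrow> ('f, 'r) deriv \<Rightarrow> ('f, 'r) deriv \<Rightarrow> bool" where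
  "eq_closure S T Hs s d e \<longleftrightarrow> derives S Hs d s \<and> derives S Hs e s \<and>
     equivclp (\<lambda>x y. derives S Hs x s \<and> derives S Hs y s \<and> T x y) d e"

definition cut_eq ::
    "('f, 'r) calculus \<Rightarrow> 'f sequent list \<Rightarrow> 'f sequent \<Rightarrow>
     ('f, 'r) deriv \<Rightarrow> ('f, 'r) deriv \<Rightarrow> bool" where
  "cut_eq S = eq_closure S (at_sub (conv S))"

text \<open>
  Switching an inference by \<open>R\<close> with the inference by \<open>Q\<close> that yields its \<open>i\<close>-th premise. The
  inference by \<open>R\<close> is moved above the premises of \<open>Q\<close> with index in \<open>J\<close> (those on which it acts),
  together with its other immediate subderivations.

  The two rules must act on the same occurrences of formulae before and after the switch. To express
  this, all occurrences in the two inferences are given names: \<open>r\<close> and \<open>q\<close> are the schemata of \<open>R\<close>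
  and \<open>Q\<close> with a name for every displayed occurrence, names are distinct within each sequent, and
  each inference transmits the names in its context (and its passive succedent) unchanged. Without
  names, contracting a freshly weakened formula could, for instance, be switched into contracting
  two old formulae before weakening. Here \<open>ps\<close>, \<open>us\<close> and \<open>us'\<close> are the premises of the inference by
  \<open>R\<close> and of those by \<open>Q\<close> before and after the switch; \<open>c\<close> is the common conclusion.
\<close>

abbreviation unname :: "('f \<times> nat) list list \<Rightarrow> 'f list list" where
  "unname \<Gamma>s \<equiv> map (map fst) \<Gamma>s"

definition distinct_names :: "('f \<times> nat) sequent \<Rightarrow> bool" where
  "distinct_names s \<longleftrightarrow> distinct (map snd (fst s @ [snd s]))"

inductive switch :: "('f, 'r) calculus \<Rightarrow> ('f, 'r) deriv \<Rightarrow> ('f, 'r) deriv \<Rightarrow> bool"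
  for S :: "('f, 'r) calculus" where
  "switch S
     (Infer R (unname \<Gamma>s) (fst (snd c)) ds)
     (Infer Q (unname \<Delta>s') (fst (snd c))
        (map (\<lambda>j. if j \<in> J
                   then Infer R (unname (\<Gamma>s' j)) (fst (snd (us' ! j))) (ds[i := es ! j])
                   else es ! j) [0..<length es]))"
  if "map_schema fst r = rule_schema S R"
    and "map_schema fst q = rule_schema S Q"
    and "distinct (map snd (displayed r @ displayed q))"
    and "\<forall>s \<in> set (c # ps @ us @ us'). distinct_names s"
    and "length ds = length ps" and "length es = length us"
    and "i < length ds"
    and "ds ! i = Infer Q (unname \<Delta>s) (fst (snd (ps ! i))) es"
    and "instance_of r \<Gamma>s ps c"
    and "instance_of q \<Delta>s us (ps ! i)"
    and "J \<noteq> {}" and "J \<subseteq> {..<length es}"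
    and "instance_of q \<Delta>s' us' c"
    and "\<forall>j \<in> J. instance_of r (\<Gamma>s' j) (ps[i := us ! j]) (us' ! j)"
    and "\<forall>j \<in> {..<length es} - J. us' ! j = us ! j"

definition perm_eq ::
    "('f, 'r) calculus \<Rightarrow> 'f sequent list \<Rightarrow> 'f sequent \<Rightarrow>
     ('f, 'r) deriv \<Rightarrow> ('f, 'r) deriv \<Rightarrow> bool" where
  "perm_eq S Hs s = eq_closure S (\<lambda>d e. cut_eq S Hs s d e \<or> at_sub (switch S) d e) Hs s"


section \<open>The standing assumptions on the calculus\<close>

text \<open>
  \<open>conv_subst\<close>: conversions do not look into the derivations put in place of extra axioms, so
  equality of derivations is a congruence for composition. The last three assumptions say that
  axioms and cuts are the identities and the composition of a category; the right unit law
  is also required for derivations with extra axioms, as a functor into multi-arrows that cuts an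
  extra axiom with its argument can preserve identities only then.
\<close>

locale sequent_calculus =
  fixes S :: "('f, 'r) calculus"
  assumes conv_derives: "conv S d e \<Longrightarrow> derives S Hs d s \<Longrightarrow> derives S Hs e s"
    and conv_subst:
      "conv S d e \<Longrightarrow> derives S Hs d s \<Longrightarrow>
       (\<And>i. i < length Hs \<Longrightarrow> derives S Ks (\<sigma> i) (Hs ! i)) \<Longrightarrow>
       cut_eq S Ks s (subst \<sigma> d) (subst \<sigma> e)"
    and cut_elimination:
      "derives S [] d s \<Longrightarrow> \<exists>n. (at_sub (conv S))\<^sup>*\<^sup>* d n \<and> cut_free n"
    and cut_axiom_right:
      "derives S Hs d (\<Gamma>, E) \<Longrightarrow> cut_eq S Hs (\<Gamma>, E) (cut_deriv \<Gamma> E E d (axiom E)) d"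
    and cut_axiom_left:
      "derives S [] d ([E], F) \<Longrightarrow> cut_eq S [] ([E], F) (cut_deriv [E] E F (axiom E) d) d"
    and cut_assoc:
      "derives S [] d ([E], F) \<Longrightarrow> derives S [] e ([F], G) \<Longrightarrow> derives S [] f ([G], H) \<Longrightarrow>
       cut_eq S [] ([E], H)
         (cut_deriv [E] G H (cut_deriv [E] F G d e) f)
         (cut_deriv [E] F H d (cut_deriv [F] G H e f))"


section \<open>Categories, multicategories, natural transformations\<close>

record ('o, 'a) cat =
  chom :: "'o \<Rightarrow> 'o \<Rightarrow> 'a set"
  cid :: "'o \<Rightarrow> 'a"
  ccomp :: "'a \<Rightarrow> 'a \<Rightarrow> 'a"

record ('o, 'm) multicat =
  mhom :: "'o list \<Rightarrow> 'o \<Rightarrow> 'm set"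
  mid :: "'o \<Rightarrow> 'm"
  mcomp :: "'m \<Rightarrow> 'm list \<Rightarrow> 'm"

record ('o, 'a, 'p, 'm) mfunctor =
  fobj :: "'o \<Rightarrow> 'p"
  farr :: "'a \<Rightarrow> 'm"

definition is_functor ::
    "('o, 'a) cat \<Rightarrow> ('p, 'm) multicat \<Rightarrow> ('o, 'a, 'p, 'm) mfunctor \<Rightarrow> bool" where
  "is_functor C M F \<longleftrightarrow>
     (\<forall>X Y. \<forall>f \<in> chom C X Y. farr F f \<in> mhom M [fobj F X] (fobj F Y)) \<and>
     (\<forall>X. farr F (cid C X) = mid M (fobj F X)) \<and>
     (\<forall>X Y Z. \<forall>f \<in> chom C X Y. \<forall>g \<in> chom C Y Z.
        farr F (ccomp C g f) = mcomp M (farr F g) [farr F f])"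

definition natural_transformation ::
    "('o, 'a) cat \<Rightarrow> ('p, 'm) multicat \<Rightarrow> ('o, 'a, 'p, 'm) mfunctor list \<Rightarrow>
     ('o, 'a, 'p, 'm) mfunctor \<Rightarrow> ('o \<Rightarrow> 'm) \<Rightarrow> bool" where
  "natural_transformation C M Fs G \<theta> \<longleftrightarrow>
     (\<forall>F \<in> set Fs. is_functor C M F) \<and> is_functor C M G \<and>
     (\<forall>X. \<theta> X \<in> mhom M (map (\<lambda>F. fobj F X) Fs) (fobj G X)) \<and>
     (\<forall>X Y. \<forall>f \<in> chom C X Y.
        mcomp M (\<theta> Y) (map (\<lambda>F. farr F f) Fs) = mcomp M (farr G f) [\<theta> X])"


section \<open>Formulae and sequents\<close>

text \<open>Arrows of both structures are equivalence classes of derivations with their source and target.\<close>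

type_synonym ('f, 'r) arrow = "'f \<times> ('f, 'r) deriv \<times> 'f"
type_synonym ('f, 'r) marrow = "'f sequent list \<times> ('f, 'r) deriv \<times> 'f sequent"

definition cut_rel :: "('f, 'r) calculus \<Rightarrow> (('f, 'r) arrow \<times> ('f, 'r) arrow) set" where
  "cut_rel S = {((E, d, F), (E, e, F)) | E d e F. cut_eq S [] ([E], F) d e}"

definition perm_rel :: "('f, 'r) calculus \<Rightarrow> (('f, 'r) marrow \<times> ('f, 'r) marrow) set" where
  "perm_rel S = {((Hs, d, s), (Hs, e, s)) | Hs d e s. perm_eq S Hs s d e}"

abbreviation cut_class :: "('f, 'r) calculus \<Rightarrow> ('f, 'r) arrow \<Rightarrow> ('f, 'r) arrow set" where
  "cut_class S f \<equiv> cut_rel S `` {f}"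

abbreviation perm_class :: "('f, 'r) calculus \<Rightarrow> ('f, 'r) marrow \<Rightarrow> ('f, 'r) marrow set" where
  "perm_class S f \<equiv> perm_rel S `` {f}"

fun comp_arrow :: "('f, 'r) arrow \<Rightarrow> ('f, 'r) arrow \<Rightarrow> ('f, 'r) arrow" where
  "comp_arrow (F', e, G) (E, d, F) = (E, cut_deriv [E] F G d e, G)"

definition Formulae :: "('f, 'r) calculus \<Rightarrow> ('f, ('f, 'r) arrow set) cat" where
  "Formulae S =
     \<lparr> chom = (\<lambda>E F. {(E, d, F) | d. derives S [] d ([E], F)} // cut_rel S),
       cid = (\<lambda>E. cut_class S (E, axiom E, E)),
       ccomp = (\<lambda>g f. \<Union>y \<in> g. \<Union>x \<in> f. cut_class S (comp_arrow y x)) \<rparr>"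

text \<open>
  The extra axioms of a composite are those of the inner multi-arrows, one after the other, so the
  extra axioms of the \<open>i\<close>-th inner multi-arrow are renumbered.
\<close>

fun comp_marrow :: "('f, 'r) marrow \<Rightarrow> ('f, 'r) marrow list \<Rightarrow> ('f, 'r) marrow" where
  "comp_marrow (Hs, d, s) fs =
     (concat (map fst fs),
      subst (\<lambda>i. subst (\<lambda>k. Hyp (length (concat (map fst (take i fs))) + k)) (fst (snd (fs ! i)))) d,
      s)"

definition MultiSequents_perm ::
    "('f, 'r) calculus \<Rightarrow> ('f sequent, ('f, 'r) marrow set) multicat" where
  "MultiSequents_perm S =
     \<lparr> mhom = (\<lambda>Hs s. {(Hs, d, s) | d. derives S Hs d s} // perm_rel S),
       mid = (\<lambda>s. perm_class S ([s], Hyp 0, s)),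
       mcomp = (\<lambda>g fs. \<Union>y \<in> g. \<Union>xs \<in> listset fs. perm_class S (comp_marrow y xs)) \<rparr>"

fun Phi_deriv :: "'f list \<Rightarrow> 'f \<Rightarrow> ('f, 'r) arrow \<Rightarrow> ('f, 'r) marrow" where
  "Phi_deriv D X (E, d, F) =
     ([(D @ [X], E)], cut_deriv (D @ [X]) E F (Hyp 0) d, (D @ [X], F))"

definition Phi ::
    "('f, 'r) calculus \<Rightarrow> 'f list \<Rightarrow> 'f \<Rightarrow>
     ('f, ('f, 'r) arrow set, 'f sequent, ('f, 'r) marrow set) mfunctor" where
  "Phi S D X =
     \<lparr> fobj = (\<lambda>C. (D @ [X], C)),
       farr = (\<lambda>f. \<Union>x \<in> f. perm_class S (Phi_deriv D X x)) \<rparr>"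

definition or_left ::
    "('f, 'r) calculus \<Rightarrow> 'f \<Rightarrow> 'f \<Rightarrow> 'f list \<Rightarrow> 'f \<Rightarrow> ('f, 'r) marrow" where
  "or_left S A B D C =
     ([(D @ [A], C), (D @ [B], C)],
      Infer (OrL A B) [D, []] C [Hyp 0, Hyp 1],
      (D @ [lor S A B], C))"

end

theory Submission
  imports Defs
begin

text \<open>
  The left side of the naturality equation is the cut of \<open>(\<or>L)\<close> with \<open>\<Pi>\<close>; moving this cut above both
  premises of \<open>(\<or>L)\<close>, which duplicates \<open>\<Pi>\<close>, gives the right side, so a single free permutation
  suffices. Functoriality of \<open>\<Phi>\<close> is a permutation as well: associativity of cuts whose leftmost
  premise is an extra axiom is not a standing assumption, but moving the lower cut above the right
  premise of the upper one provides it. The rest is that both equalities are congruences for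
  composition.
\<close>

section \<open>Substitution into derivations, and the shapes of cut and (\<or>L)\<close>

inductive_cases derives_InferE: "derives S Hs (Infer R \<Gamma>s C ds) c"

lemma derives_subst:
  assumes "derives S Hs d s" and "\<And>i. i < length Hs \<Longrightarrow> derives S Ks (\<sigma> i) (Hs ! i)"
  shows "derives S Ks (subst \<sigma> d) s"
  using assms(1)
proof induction
  case (hyp i)
  then show ?case using assms(2) by simp
next
  case (inf R \<Gamma>s ps c ds)
  have "list_all2 (derives S Ks) (map (subst \<sigma>) ds) ps"
    unfolding list_all2_map1 using inf(3) by (rule list_all2_mono) simp
  then show ?case using derives.inf[OF inf(1,2)] by simp
qed

text \<open>Without extra axioms there is no leaf \<open>Hyp\<close> to replace. This is why
  composition in the multicategory leaves \<open>\<Pi>\<close> untouched, both when extra axioms are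
  filled and when they are renumbered.\<close>

lemma subst_closed:
  assumes "derives S [] d s"
  shows "subst \<sigma> d = d"
  using assms
proof induction
  case (inf R \<Gamma>s ps c ds)
  have "list_all2 (\<lambda>d s. subst \<sigma> d = d) ds ps"
    using inf(3) by (rule list_all2_mono) simp
  then have "map (subst \<sigma>) ds = ds"
    by (auto simp: list_all2_conv_all_nth intro: nth_equalityI)
  then show ?case by simp
qed simp

lemma derives_weaken_hyps: "derives S [] d s \<Longrightarrow> derives S Ks d s"
  using derives_subst[of S "[]" d s Ks Hyp] subst_closed by fastforce

text \<open>The two occurrences \<open>a\<close> and \<open>b\<close> of the cut formula are kept
  apart because named copies of it carry different names. The index 1 appears as
  \<open>Suc 0\<close>, the form that simp produces.\<close>

lemma instance_of_Cut:
  "instance_of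
      (Schema [([Ctx 0], Some a), ([Ctx (Suc 0), Fml b, Ctx 2], None)] ([Ctx (Suc 0), Ctx 0, Ctx 2], None))
      [\<Gamma>, \<Delta>, \<Lambda>] ps c
    \<longleftrightarrow> ps = [(\<Gamma>, a), (\<Delta> @ b # \<Lambda>, snd c)] \<and> fst c = \<Delta> @ \<Gamma> @ \<Lambda>" (is "instance_of ?r _ _ _ \<longleftrightarrow> _")
proof -
  have "ctx_vars ?r = {0, 1, 2}" by (auto simp: ctx_vars_def)
  moreover have "{..<length [\<Gamma>, \<Delta>, \<Lambda>]} = {0, 1, 2}" by auto
  ultimately show ?thesis by (cases c) (auto simp: instance_of_def fill_def)
qed

text \<open>The principal formula \<open>a'\<close> is arbitrary, so that the same equivalence
  serves the plain rule and its named version.\<close>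

lemma instance_of_OrL:
  "instance_of
      (Schema [([Ctx 0, Fml a, Ctx (Suc 0)], None), ([Ctx 0, Fml b, Ctx (Suc 0)], None)]
        ([Ctx 0, Fml a', Ctx (Suc 0)], None))
      [\<Gamma>, \<Delta>] ps c
    \<longleftrightarrow> ps = [(\<Gamma> @ a # \<Delta>, snd c), (\<Gamma> @ b # \<Delta>, snd c)] \<and> fst c = \<Gamma> @ a' # \<Delta>"
    (is "instance_of ?r _ _ _ \<longleftrightarrow> _")
proof -
  have "ctx_vars ?r = {0, 1}" by (auto simp: ctx_vars_def)
  moreover have "{..<length [\<Gamma>, \<Delta>]} = {0, 1}" by auto
  ultimately show ?thesis by (cases c) (auto simp: instance_of_def fill_def)
qed

lemma derives_cut_deriv:
  "derives S Hs d (\<Gamma>, E) \<Longrightarrow> derives S Hs e ([E], F) \<Longrightarrow>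
    derives S Hs (cut_deriv \<Gamma> E F d e) (\<Gamma>, F)"
  unfolding cut_deriv_def
  using derives.inf[of S "Cut E" "[\<Gamma>, [], []]" "[(\<Gamma>, E), ([E], F)]" "(\<Gamma>, F)" Hs "[d, e]"]
  by (simp add: instance_of_Cut)

lemma derives_axiom: "derives S Hs (axiom E) ([E], E)"
  unfolding axiom_def
  using derives.inf[of S "Ax E" "[]" "[]" "([E], E)" Hs "[]"]
  by (auto simp: instance_of_def fill_def ctx_vars_def)

lemma derives_OrL:
  "derives S Hs d (D @ [A], C) \<Longrightarrow> derives S Hs e (D @ [B], C) \<Longrightarrow>
    derives S Hs (Infer (OrL A B) [D, []] C [d, e]) (D @ [lor S A B], C)"
  using derives.inf[of S "OrL A B" "[D, []]" "[(D @ [A], C), (D @ [B], C)]"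
      "(D @ [lor S A B], C)" Hs "[d, e]"]
  by (simp add: instance_of_OrL)

lemma derives_Hyp: "i < length Hs \<Longrightarrow> Hs ! i = s \<Longrightarrow> derives S Hs (Hyp i) s"
  using derives.hyp by metis

section \<open>Closure and congruence\<close>

lemma eq_closure_refl: "derives S Hs d s \<Longrightarrow> eq_closure S T Hs s d d"
  by (simp add: eq_closure_def)

lemma eq_closure_sym: "eq_closure S T Hs s d e \<Longrightarrow> eq_closure S T Hs s e d"
  by (auto simp: eq_closure_def intro: equivclp_sym)

lemma eq_closure_trans:
  "eq_closure S T Hs s d e \<Longrightarrow> eq_closure S T Hs s e f \<Longrightarrow> eq_closure S T Hs s d f"
  by (auto simp: eq_closure_def intro: equivclp_trans)

lemma eq_closure_base:
  "derives S Hs d s \<Longrightarrow> derives S Hs e s \<Longrightarrow> T d e \<Longrightarrow> eq_closure S T Hs s d e"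
  by (auto simp: eq_closure_def)

text \<open>Induction along the zigzag from \<open>d\<close> to \<open>e\<close>. It reduces the
  congruence proofs to single steps, whose images need only be equivalent, not related by one
  step.\<close>

lemma eq_closure_map:
  assumes eq: "eq_closure S T Hs s d e"
    and step: "\<And>x y. derives S Hs x s \<Longrightarrow> derives S Hs y s \<Longrightarrow> T x y \<Longrightarrow>
      eq_closure S U Ks t (f x) (f y)"
    and der: "\<And>x. derives S Hs x s \<Longrightarrow> derives S Ks (f x) t"
  shows "eq_closure S U Ks t (f d) (f e)"
proof -
  have "equivclp (\<lambda>x y. derives S Hs x s \<and> derives S Hs y s \<and> T x y) d e"
    and d: "derives S Hs d s"
    using eq by (auto simp: eq_closure_def)
  then show ?thesis
  proof (induction rule: equivclp_induct)
    case base
    then show ?case using der by (simp add: eq_closure_refl)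
  next
    case (step y z)
    then show ?case using assms(2) by (meson eq_closure_sym eq_closure_trans)
  qed
qed

lemma cut_eq_derives: "cut_eq S Hs s d e \<Longrightarrow> derives S Hs d s \<and> derives S Hs e s"
  by (simp add: cut_eq_def eq_closure_def)

lemma perm_eq_derives: "perm_eq S Hs s d e \<Longrightarrow> derives S Hs d s \<and> derives S Hs e s"
  by (simp add: perm_eq_def eq_closure_def)

lemma cut_eq_refl: "derives S Hs d s \<Longrightarrow> cut_eq S Hs s d d"
  by (simp add: cut_eq_def eq_closure_refl)

lemma cut_eq_sym: "cut_eq S Hs s d e \<Longrightarrow> cut_eq S Hs s e d"
  unfolding cut_eq_def by (rule eq_closure_sym)

lemma cut_eq_trans: "cut_eq S Hs s d e \<Longrightarrow> cut_eq S Hs s e f \<Longrightarrow> cut_eq S Hs s d f"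
  unfolding cut_eq_def by (rule eq_closure_trans)

lemma perm_eq_refl: "derives S Hs d s \<Longrightarrow> perm_eq S Hs s d d"
  by (simp add: perm_eq_def eq_closure_refl)

lemma perm_eq_sym: "perm_eq S Hs s d e \<Longrightarrow> perm_eq S Hs s e d"
  unfolding perm_eq_def by (rule eq_closure_sym)

lemma perm_eq_trans: "perm_eq S Hs s d e \<Longrightarrow> perm_eq S Hs s e f \<Longrightarrow> perm_eq S Hs s d f"
  unfolding perm_eq_def by (rule eq_closure_trans)

lemma cut_eq_imp_perm_eq: "cut_eq S Hs s d e \<Longrightarrow> perm_eq S Hs s d e"
  unfolding perm_eq_def by (simp add: eq_closure_base cut_eq_derives)

lemma switch_imp_perm_eq:
  "derives S Hs d s \<Longrightarrow> derives S Hs e s \<Longrightarrow> at_sub (switch S) d e \<Longrightarrow> perm_eq S Hs s d e"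
  unfolding perm_eq_def by (simp add: eq_closure_base)

section \<open>Congruence under inferences\<close>

lemma derives_update:
  assumes "instance_of (rule_schema S R) \<Gamma>s ps c" "side_cond S R \<Gamma>s (snd c)"
    and "list_all2 (derives S Hs) ds ps" and "derives S Hs x (ps ! i)"
  shows "derives S Hs (Infer R \<Gamma>s (snd c) (ds[i := x])) c"
proof -
  \<comment> \<open>The premises are written as a trivial update of themselves so that both lists
    are updated at the same place.\<close>
  have "list_all2 (derives S Hs) (ds[i := x]) (ps[i := ps ! i])"
    using assms(3,4) by (rule list_all2_update_cong)
  then show ?thesis using assms by (intro derives.inf) simp_all
qed

lemma at_sub_update:
  "i < length ds \<Longrightarrow> at_sub T x y \<Longrightarrow>
    at_sub T (Infer R \<Gamma>s C (ds[i := x])) (Infer R \<Gamma>s C (ds[i := y]))"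
  using at_sub.sub[of i "ds[i := x]" T y R \<Gamma>s C] by simp

lemma cut_eq_update:
  assumes inst: "instance_of (rule_schema S R) \<Gamma>s ps c" "side_cond S R \<Gamma>s (snd c)"
      "list_all2 (derives S Hs) ds ps"
    and i: "i < length ds" and eq: "cut_eq S Hs (ps ! i) d e"
  shows "cut_eq S Hs c (Infer R \<Gamma>s (snd c) (ds[i := d])) (Infer R \<Gamma>s (snd c) (ds[i := e]))"
  using eq unfolding cut_eq_def
  by (rule eq_closure_map) (auto intro!: eq_closure_base at_sub_update i derives_update[OF inst])

lemma perm_eq_update:
  assumes inst: "instance_of (rule_schema S R) \<Gamma>s ps c" "side_cond S R \<Gamma>s (snd c)"
      "list_all2 (derives S Hs) ds ps"
    and i: "i < length ds" and eq: "perm_eq S Hs (ps ! i) d e"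
  shows "perm_eq S Hs c (Infer R \<Gamma>s (snd c) (ds[i := d])) (Infer R \<Gamma>s (snd c) (ds[i := e]))"
  using eq unfolding perm_eq_def
  by (rule eq_closure_map)
    (auto intro!: eq_closure_base at_sub_update cut_eq_update[OF inst] i derives_update[OF inst])

lemma perm_eq_Infer:
  assumes inst: "instance_of (rule_schema S R) \<Gamma>s ps c" "side_cond S R \<Gamma>s (snd c)"
    and len: "length ds = length ps" "length es = length ps"
    and eq: "\<And>i. i < length ps \<Longrightarrow> perm_eq S Hs (ps ! i) (ds ! i) (es ! i)"
  shows "perm_eq S Hs c (Infer R \<Gamma>s (snd c) ds) (Infer R \<Gamma>s (snd c) es)"
proof -
  \<comment> \<open>Premises are exchanged one at a time from the left: in \<open>?mix k\<close> the
    first \<open>k\<close> are already those of \<open>es\<close>.\<close>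
  let ?mix = "\<lambda>k. take k es @ drop k ds"
  have mix: "list_all2 (derives S Hs) (?mix k) ps" if "k \<le> length ps" for k
    using that len perm_eq_derives[OF eq]
    by (auto simp: list_all2_conv_all_nth nth_append)
  have "perm_eq S Hs c (Infer R \<Gamma>s (snd c) ds) (Infer R \<Gamma>s (snd c) (?mix k))"
    if "k \<le> length ps" for k
    using that
  proof (induction k)
    case 0
    then show ?case using derives.inf[OF inst mix[of 0]] by (auto intro: perm_eq_refl)
  next
    case (Suc k)
    have "(?mix k)[k := ds ! k] = ?mix k" "(?mix k)[k := es ! k] = ?mix (Suc k)"
      using Suc.prems len
      by (auto simp: list_update_append take_Suc_conv_app_nth Cons_nth_drop_Suc[symmetric])
    then have "perm_eq S Hs c (Infer R \<Gamma>s (snd c) (?mix k)) (Infer R \<Gamma>s (snd c) (?mix (Suc k)))"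
      using perm_eq_update[OF inst mix, of k k "ds ! k" "es ! k"] eq[of k] Suc.prems len by simp
    then show ?case using Suc by (auto intro: perm_eq_trans)
  qed
  from this[of "length ps"] show ?thesis using len by simp
qed

section \<open>Congruence under substitution for extra axioms\<close>

lemma perm_eq_subst_left:
  assumes "derives S Hs d s" and "\<And>i. i < length Hs \<Longrightarrow> perm_eq S Ks (Hs ! i) (\<sigma> i) (\<tau> i)"
  shows "perm_eq S Ks s (subst \<sigma> d) (subst \<tau> d)"
  using assms(1)
proof induction
  case (hyp i)
  then show ?case using assms(2) by simp
next
  case (inf R \<Gamma>s ps c ds)
  then show ?case
    by (auto simp: list_all2_conv_all_nth intro: perm_eq_Infer[OF inf(1,2)])
qed

text \<open>The conditions of a switch concern the two inferences only; of the subderivations above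
  them just the number matters. The same named schemata, contexts and set \<open>J\<close> therefore
  witness the switch after substitution.\<close>

lemma switch_subst:
  assumes "switch S d e"
  shows "switch S (subst \<sigma> d) (subst \<sigma> e)"
  using assms
proof cases
  case (1 r R q Q c ps us us' ds es i \<Delta>s \<Gamma>s J \<Delta>s' \<Gamma>s')
  have "switch S
     (Infer R (unname \<Gamma>s) (fst (snd c)) (map (subst \<sigma>) ds))
     (Infer Q (unname \<Delta>s') (fst (snd c))
        (map (\<lambda>j. if j \<in> J
            then Infer R (unname (\<Gamma>s' j)) (fst (snd (us' ! j)))
              ((map (subst \<sigma>) ds)[i := map (subst \<sigma>) es ! j])
            else map (subst \<sigma>) es ! j) [0..<length (map (subst \<sigma>) es)]))"
    using 1 by (intro switch.intros[of r S R q Q c ps us us' _ _ i \<Delta>s]) simp_all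
  moreover have "(map (\<lambda>j. if j \<in> J
            then Infer R (unname (\<Gamma>s' j)) (fst (snd (us' ! j)))
              ((map (subst \<sigma>) ds)[i := map (subst \<sigma>) es ! j])
            else map (subst \<sigma>) es ! j) [0..<length (map (subst \<sigma>) es)]) =
      map (subst \<sigma>) (map (\<lambda>j. if j \<in> J
            then Infer R (unname (\<Gamma>s' j)) (fst (snd (us' ! j))) (ds[i := es ! j])
            else es ! j) [0..<length es])"
    by (auto simp: map_update)
  ultimately show ?thesis unfolding 1(1,2) by (simp only: subst.simps)
qed

lemma at_sub_switch_subst:
  "at_sub (switch S) d e \<Longrightarrow> at_sub (switch S) (subst \<sigma> d) (subst \<sigma> e)"
proof (induction rule: at_sub.induct)
  case (root d e)
  then show ?case by (intro at_sub.root switch_subst)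
next
  case (sub i ds e R \<Gamma>s C)
  then show ?case using at_sub.sub[of i "map (subst \<sigma>) ds"] by (simp add: map_update)
qed

context sequent_calculus
begin

lemma at_sub_conv_derives:
  "at_sub (conv S) d e \<Longrightarrow> derives S Hs d s \<Longrightarrow> derives S Hs e s"
proof (induction arbitrary: s rule: at_sub.induct)
  case (root d e)
  then show ?case by (rule conv_derives)
next
  case (sub i ds e R \<Gamma>s C)
  from sub.prems obtain ps where "C = snd s" "instance_of (rule_schema S R) \<Gamma>s ps s"
      "side_cond S R \<Gamma>s (snd s)" "list_all2 (derives S Hs) ds ps"
    by (auto elim: derives_InferE)
  then show ?case
    using sub.hyps sub.IH derives_update by (metis list_all2_nthD)
qed

text \<open>At the root this is the assumption \<open>conv_subst\<close>, which yields an equality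
  rather than one conversion; \<open>cut_eq_update\<close> carries that equality down through the
  surrounding inferences.\<close>

lemma at_sub_conv_subst:
  assumes "at_sub (conv S) d e" and "derives S Hs d s"
    and "\<And>i. i < length Hs \<Longrightarrow> derives S Ks (\<sigma> i) (Hs ! i)"
  shows "cut_eq S Ks s (subst \<sigma> d) (subst \<sigma> e)"
  using assms(1,2)
proof (induction arbitrary: s rule: at_sub.induct)
  case (root d e)
  then show ?case using conv_subst assms(3) by blast
next
  case (sub i ds e R \<Gamma>s C)
  from sub.prems obtain ps where C: "C = snd s" and inst: "instance_of (rule_schema S R) \<Gamma>s ps s"
      "side_cond S R \<Gamma>s (snd s)" and ds: "list_all2 (derives S Hs) ds ps"
    by (auto elim: derives_InferE)
  have "list_all2 (derives S Ks) (map (subst \<sigma>) ds) ps"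
    unfolding list_all2_map1 using ds by (rule list_all2_mono) (auto intro: derives_subst assms(3))
  moreover have "cut_eq S Ks (ps ! i) (subst \<sigma> (ds ! i)) (subst \<sigma> e)"
    by (rule sub.IH) (rule list_all2_nthD[OF ds sub.hyps(1)])
  ultimately have "cut_eq S Ks s (Infer R \<Gamma>s C ((map (subst \<sigma>) ds)[i := subst \<sigma> (ds ! i)]))
     (Infer R \<Gamma>s C ((map (subst \<sigma>) ds)[i := subst \<sigma> e]))"
    unfolding C using cut_eq_update[OF inst] sub.hyps(1) by simp
  moreover have "(map (subst \<sigma>) ds)[i := subst \<sigma> (ds ! i)] = map (subst \<sigma>) ds"
    using sub(1) by (metis list_update_id map_update)
  ultimately show ?case by (simp add: map_update)
qed

lemma cut_eq_subst:
  assumes "cut_eq S Hs s d e" and "\<And>i. i < length Hs \<Longrightarrow> derives S Ks (\<sigma> i) (Hs ! i)"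
  shows "cut_eq S Ks s (subst \<sigma> d) (subst \<sigma> e)"
  using assms(1) unfolding cut_eq_def
  by (rule eq_closure_map)
    (auto intro: derives_subst assms(2) at_sub_conv_subst[unfolded cut_eq_def])

lemma perm_eq_subst_right:
  assumes "perm_eq S Hs s d e" and "\<And>i. i < length Hs \<Longrightarrow> derives S Ks (\<sigma> i) (Hs ! i)"
  shows "perm_eq S Ks s (subst \<sigma> d) (subst \<sigma> e)"
  using assms(1) unfolding perm_eq_def
  by (rule eq_closure_map)
    (auto intro: derives_subst assms(2) intro!: eq_closure_base cut_eq_subst at_sub_switch_subst)

text \<open>First the outer derivation varies with \<open>\<sigma>\<close> fixed, then the
  substituted derivations vary inside \<open>e\<close>.\<close>

lemma perm_eq_subst:
  assumes "perm_eq S Hs s d e" and "\<And>i. i < length Hs \<Longrightarrow> perm_eq S Ks (Hs ! i) (\<sigma> i) (\<tau> i)"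
  shows "perm_eq S Ks s (subst \<sigma> d) (subst \<tau> e)"
  using perm_eq_subst_right[OF assms(1), of Ks \<sigma>] perm_eq_subst_left[of S Hs e s Ks \<sigma> \<tau>] assms
  by (meson perm_eq_derives perm_eq_trans)

text \<open>Arrows of \<open>Formulae\<close> are compared without extra axioms, whereas their
  images under \<open>Phi\<close> have one. Any substitution acts trivially on closed derivations,
  so congruence for substitution gives the passage.\<close>

lemma cut_eq_weaken_hyps: "cut_eq S [] s d e \<Longrightarrow> cut_eq S Ks s d e"
  using cut_eq_subst[of "[]" s d e Ks Hyp] subst_closed[of S _ s Hyp] cut_eq_derives by fastforce

lemma cut_eq_cut_deriv:
  assumes d: "cut_eq S Hs (\<Gamma>, E) d d'" and e: "cut_eq S Hs ([E], F) e e'"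
  shows "cut_eq S Hs (\<Gamma>, F) (cut_deriv \<Gamma> E F d e) (cut_deriv \<Gamma> E F d' e')"
proof -
  have inst: "instance_of (rule_schema S (Cut E)) [\<Gamma>, [], []] [(\<Gamma>, E), ([E], F)] (\<Gamma>, F)"
    by (simp add: instance_of_Cut)
  show ?thesis
    unfolding cut_deriv_def
    using cut_eq_update[OF inst, of Hs "[d, e]" 0 d d'] cut_eq_update[OF inst, of Hs "[d', e]" 1 e e']
      d e cut_eq_derives[OF d] cut_eq_derives[OF e] by (auto intro: cut_eq_trans)
qed

end

section \<open>The two free permutations\<close>

text \<open>
  In both permutations the names 0 to 4 go to the displayed formulae and 5 to the passive succedent;
  contexts are named from 6 on.
\<close>

lemma named_copy:
  obtains D' :: "('f \<times> nat) list"
  where "map fst D' = D" "distinct (map snd D')" "snd ` set D' = {k..<k + length D}"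
proof
  let ?D' = "zip D [k..<k + length D]"
  show "map fst ?D' = D" by simp
  have "map snd ?D' = [k..<k + length D]" by simp
  then show "distinct (map snd ?D')" "snd ` set ?D' = {k..<k + length D}"
    by (metis distinct_upt, metis set_map set_upt)
qed

text \<open>The cut formula \<open>E\<close> with name 0 is the passive succedent of (\<or>L), hence
  stands in both of its premises. The cut acts on both, and \<open>p\<close> is duplicated.\<close>

lemma switch_cut_OrL:
  "switch S (cut_deriv (D @ [lor S A B]) E F (Infer (OrL A B) [D, []] E [d, e]) p)
    (Infer (OrL A B) [D, []] F [cut_deriv (D @ [A]) E F d p, cut_deriv (D @ [B]) E F e p])"
proof -
  obtain D' :: "('a \<times> nat) list" where D': "map fst D' = D" "distinct (map snd D')"
      "snd ` set D' = {6..<6 + length D}"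
    by (rule named_copy)
  \<comment> \<open>The context is named from 6 on, so it cannot meet the reserved names 0 to
    5.\<close>
  have fresh: "(a, n) \<notin> set D'" if "n < 6" for a n
    using D'(3) that by (metis atLeastLessThan_iff imageI leD snd_conv)
  let ?r = "Schema [([Ctx 0], Some (E, 0)), ([Ctx 1, Fml (E, 1), Ctx 2], None)]
     ([Ctx 1, Ctx 0, Ctx 2], None)"
  let ?q = "Schema [([Ctx 0, Fml (A, 2), Ctx 1], None), ([Ctx 0, Fml (B, 3), Ctx 1], None)]
       ([Ctx 0, Fml (lor S A B, 4), Ctx 1], None)"
  let ?Fn = "(F, 5::nat)"
  \<comment> \<open>The premises of (\<or>L) have succedent \<open>E\<close> while the cut is below,
    and \<open>F\<close> once it is above; the active formulae keep their names.\<close>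
  let ?us = "[(D' @ [(A, 2)], (E, 0)), (D' @ [(B, 3)], (E, 0))]"
  let ?us' = "[(D' @ [(A, 2)], ?Fn), (D' @ [(B, 3)], ?Fn)]"
  \<comment> \<open>The instance has \<open>i = 0\<close>, since (\<or>L) yields the left premise of
    the cut, and \<open>J = {0, 1}\<close>. The moved cut takes the active formula of its branch
    into its context.\<close>
  have "switch S
     (Infer (Cut E) (unname [D' @ [(lor S A B, 4)], [], []]) (fst (snd (D' @ [(lor S A B, 4)], ?Fn)))
        [Infer (OrL A B) [D, []] E [d, e], p])
     (Infer (OrL A B) (unname [D', []]) (fst (snd (D' @ [(lor S A B, 4)], ?Fn)))
        (map (\<lambda>j. if j \<in> {0, 1}
              then Infer (Cut E) (unname [D' @ [if j = 0 then (A, 2) else (B, 3)], [], []])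
                (fst (snd (?us' ! j))) ([Infer (OrL A B) [D, []] E [d, e], p][0 := [d, e] ! j])
              else [d, e] ! j) [0..<length [d, e]]))"
    using D'(1,2)
    by (intro switch.intros[of ?r S "Cut E" ?q "OrL A B" _ "[(D' @ [(lor S A B, 4)], (E, 0)), ([(E, 1)], ?Fn)]"
          ?us ?us' _ _ 0 "[D', []]"])
      (auto simp: instance_of_Cut instance_of_OrL displayed_def distinct_names_def fresh)
  then show ?thesis using D'(1) by (simp add: cut_deriv_def)
qed

text \<open>The passive succedent \<open>F\<close> of the upper cut comes from its right premise
  alone, so only that premise receives the lower cut. Here \<open>d\<close> is arbitrary, whereas
  \<open>cut_assoc\<close> speaks of closed derivations.\<close>

lemma switch_cut_cut:
  "switch S (cut_deriv \<Gamma> F G (cut_deriv \<Gamma> E F d e) f) (cut_deriv \<Gamma> E G d (cut_deriv [E] F G e f))"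
proof -
  obtain \<Gamma>' :: "('a \<times> nat) list" where \<Gamma>': "map fst \<Gamma>' = \<Gamma>" "distinct (map snd \<Gamma>')"
      "snd ` set \<Gamma>' = {6..<6 + length \<Gamma>}"
    by (rule named_copy)
  have fresh: "(a, n) \<notin> set \<Gamma>'" if "n < 6" for a n
    using \<Gamma>'(3) that by (metis atLeastLessThan_iff imageI leD snd_conv)
  let ?r = "Schema [([Ctx 0], Some (F, 0)), ([Ctx 1, Fml (F, 1), Ctx 2], None)]
     ([Ctx 1, Ctx 0, Ctx 2], None)"
  let ?q = "Schema [([Ctx 0], Some (E, 2)), ([Ctx 1, Fml (E, 3), Ctx 2], None)]
     ([Ctx 1, Ctx 0, Ctx 2], None)"
  let ?Gn = "(G, 5::nat)"
  let ?us = "[(\<Gamma>', (E, 2)), ([(E, 3)], (F, 0))]"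
  let ?us' = "[(\<Gamma>', (E, 2)), ([(E, 3)], ?Gn)]"
  \<comment> \<open>Now \<open>J = {1}\<close>. Above the right premise, the context of the moved
    cut is the single formula \<open>E\<close> instead of \<open>\<Gamma>\<close>.\<close>
  have "switch S
     (Infer (Cut F) (unname [\<Gamma>', [], []]) (fst (snd (\<Gamma>', ?Gn)))
        [Infer (Cut E) [\<Gamma>, [], []] F [d, e], f])
     (Infer (Cut E) (unname [\<Gamma>', [], []]) (fst (snd (\<Gamma>', ?Gn)))
        (map (\<lambda>j. if j \<in> {1}
              then Infer (Cut F) (unname [[(E, 3)], [], []])
                (fst (snd (?us' ! j))) ([Infer (Cut E) [\<Gamma>, [], []] F [d, e], f][0 := [d, e] ! j])
              else [d, e] ! j) [0..<length [d, e]]))"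
    using \<Gamma>'(1,2)
    by (intro switch.intros[of ?r S "Cut F" ?q "Cut E" _ "[(\<Gamma>', (F, 0)), ([(F, 1)], ?Gn)]"
          ?us ?us' _ _ 0 "[\<Gamma>', [], []]"])
      (auto simp: instance_of_Cut displayed_def distinct_names_def fresh nth_Cons')
  then show ?thesis using \<Gamma>'(1) by (simp add: cut_deriv_def)
qed

section \<open>Composition on equivalence classes\<close>

lemma in_perm_class:
  "x \<in> perm_class S (Hs, d, s) \<longleftrightarrow> (\<exists>e. x = (Hs, e, s) \<and> perm_eq S Hs s d e)"
  by (cases s) (auto simp: perm_rel_def)

lemma in_cut_class:
  "x \<in> cut_class S (E, d, F) \<longleftrightarrow> (\<exists>e. x = (E, e, F) \<and> cut_eq S [] ([E], F) d e)"
  by (auto simp: cut_rel_def)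

lemma perm_class_eqI:
  "perm_eq S Hs s d e \<Longrightarrow> perm_class S (Hs, d, s) = perm_class S (Hs, e, s)"
  unfolding set_eq_iff in_perm_class by (blast intro: perm_eq_trans perm_eq_sym)

lemma cut_class_eqI:
  "cut_eq S [] ([E], F) d e \<Longrightarrow> cut_class S (E, d, F) = cut_class S (E, e, F)"
  unfolding set_eq_iff in_cut_class by (blast intro: cut_eq_trans cut_eq_sym)

text \<open>Operations on classes are unions over representatives. Once all representatives give the
  same class, the union is that class; \<open>x\<close> ensures that there is a
  representative.\<close>

lemma UN_constant_eqI: "x \<in> X \<Longrightarrow> (\<And>y. y \<in> X \<Longrightarrow> f y = c) \<Longrightarrow> (\<Union>y\<in>X. f y) = c"
  by auto

lemma perm_class_mhom:
  "derives S Hs d s \<Longrightarrow> perm_class S (Hs, d, s) \<in> mhom (MultiSequents_perm S) Hs s"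
  by (auto simp: MultiSequents_perm_def quotient_def)

lemma chom_cases:
  assumes "f \<in> chom (Formulae S) E F"
  obtains d where "derives S [] d ([E], F)" "f = cut_class S (E, d, F)"
  using assms by (auto simp: Formulae_def elim!: quotientE)

context sequent_calculus
begin

text \<open>Composition may be computed on representatives because \<open>perm_eq\<close> is a
  congruence for substitution, in the outer derivation and in the inner ones.\<close>

lemma mcomp_classes:
  assumes d: "derives S (map (\<lambda>f. snd (snd f)) fs) d s"
    and fs: "\<forall>f \<in> set fs. derives S (fst f) (fst (snd f)) (snd (snd f))"
  shows "mcomp (MultiSequents_perm S) (perm_class S (map (\<lambda>f. snd (snd f)) fs, d, s))
        (map (perm_class S) fs)
    = perm_class S (comp_marrow (map (\<lambda>f. snd (snd f)) fs, d, s) fs)"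
proof -
  let ?Hs = "map (\<lambda>f. snd (snd f)) fs"
  have listset: "xs \<in> listset (map (perm_class S) fs) \<longleftrightarrow>
      list_all2 (\<lambda>x f. x \<in> perm_class S f) xs fs" for xs
    by (induction fs arbitrary: xs) (auto simp: set_Cons_def list_all2_Cons2)
  \<comment> \<open>Correct derivations lie in their own classes, so the union over choices of
    representatives is not empty.\<close>
  have self: "fs \<in> listset (map (perm_class S) fs)"
    unfolding listset using fs
    by (auto simp: list_all2_conv_all_nth perm_rel_def)
      (metis nth_mem perm_eq_refl prod.collapse)
  have "perm_class S (comp_marrow y xs) = perm_class S (comp_marrow (?Hs, d, s) fs)"
    if y: "y \<in> perm_class S (?Hs, d, s)" and xs: "xs \<in> listset (map (perm_class S) fs)" for y xs
  proof -
    obtain e where y_eq: "y = (?Hs, e, s)" and e: "perm_eq S ?Hs s d e"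
      using y unfolding in_perm_class by blast
    have len: "length xs = length fs" using xs by (auto simp: listset list_all2_lengthD)
    have nth: "fst (xs ! i) = fst (fs ! i) \<and>
        perm_eq S (fst (fs ! i)) (snd (snd (fs ! i))) (fst (snd (fs ! i))) (fst (snd (xs ! i)))"
      if "i < length fs" for i
    proof -
      have "xs ! i \<in> perm_class S (fs ! i)"
        using list_all2_nthD2[OF xs[unfolded listset] that] .
      then show ?thesis by (cases "fs ! i") (auto simp: perm_rel_def)
    qed
    \<comment> \<open>Equivalent representatives have the same extra axioms, hence the same offsets
      for renumbering.\<close>
    have fst_eq: "map fst xs = map fst fs"
      using nth len by (auto intro: nth_equalityI)
    let ?K = "concat (map fst fs)"
    let ?off = "\<lambda>i. length (concat (map fst (take i fs)))"
    have off_eq: "map fst (take i xs) = map fst (take i fs)" for i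
      using fst_eq by (simp add: take_map[symmetric])
    \<comment> \<open>Renumbering is correct: extra axiom \<open>k\<close> of the inner arrow
      \<open>i\<close> stands at position \<open>?off i + k\<close> of the concatenated
      list.\<close>
    have ren: "derives S ?K (Hyp (?off i + k)) (fst (fs ! i) ! k)"
      if i: "i < length fs" and k: "k < length (fst (fs ! i))" for i k
    proof (rule derives_Hyp)
      have split: "?K = concat (map fst (take i fs)) @ fst (fs ! i) @ concat (map fst (drop (Suc i) fs))"
        using id_take_nth_drop[OF i] by (metis concat.simps(2) concat_append list.simps(9) map_append)
      show "?off i + k < length ?K" unfolding split using k by simp
      show "?K ! (?off i + k) = fst (fs ! i) ! k"
        unfolding split using k by (simp add: nth_append)
    qed
    \<comment> \<open>Two nested congruences: the inner one for renumbering each component, the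
      outer one for inserting the components into \<open>d\<close> and \<open>e\<close>.\<close>
    have "perm_eq S ?K s
        (subst (\<lambda>i. subst (\<lambda>k. Hyp (?off i + k)) (fst (snd (fs ! i)))) d)
        (subst (\<lambda>i. subst (\<lambda>k. Hyp (?off i + k)) (fst (snd (xs ! i)))) e)"
      using e by (rule perm_eq_subst) (auto intro!: perm_eq_subst_right[of "fst (fs ! _)"] ren simp: nth)
    then show ?thesis
      unfolding y_eq by (simp add: fst_eq off_eq perm_class_eqI[symmetric])
  qed
  moreover have "(?Hs, d, s) \<in> perm_class S (?Hs, d, s)"
    unfolding in_perm_class using d by (auto intro: perm_eq_refl)
  ultimately have "(\<Union>y \<in> perm_class S (?Hs, d, s).
      \<Union>xs \<in> listset (map (perm_class S) fs). perm_class S (comp_marrow y xs))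
    = perm_class S (comp_marrow (?Hs, d, s) fs)"
    using self by (intro UN_constant_eqI)
  then show ?thesis by (simp add: MultiSequents_perm_def)
qed

section \<open>Functoriality of \<open>Phi\<close>\<close>

lemma farr_Phi:
  assumes "derives S [] d ([E], F)"
  shows "farr (Phi S D X) (cut_class S (E, d, F)) = perm_class S (Phi_deriv D X (E, d, F))"
proof -
  have eq: "perm_class S (Phi_deriv D X x) = perm_class S (Phi_deriv D X (E, d, F))"
    if mem: "x \<in> cut_class S (E, d, F)" for x
  proof -
    obtain e where x: "x = (E, e, F)" and e: "cut_eq S [] ([E], F) d e"
      using mem unfolding in_cut_class by blast
    have hyp: "cut_eq S [(D @ [X], E)] (D @ [X], E) (Hyp 0) (Hyp 0)"
      by (rule cut_eq_refl[OF derives_Hyp]) simp_all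
    show ?thesis
      unfolding x Phi_deriv.simps
      by (rule perm_class_eqI[OF cut_eq_imp_perm_eq, symmetric],
          rule cut_eq_cut_deriv[OF hyp cut_eq_weaken_hyps[OF e]])
  qed
  have "(E, d, F) \<in> cut_class S (E, d, F)"
    unfolding in_cut_class using assms by (auto intro: cut_eq_refl)
  from UN_constant_eqI[where f = "\<lambda>x. perm_class S (Phi_deriv D X x)", OF this eq] show ?thesis
    by (simp add: Phi_def)
qed

lemma ccomp_classes:
  assumes d: "derives S [] d ([E], F)" and e: "derives S [] e ([F], G)"
  shows "ccomp (Formulae S) (cut_class S (F, e, G)) (cut_class S (E, d, F))
    = cut_class S (E, cut_deriv [E] F G d e, G)"
proof -
  have "cut_class S (comp_arrow y x) = cut_class S (E, cut_deriv [E] F G d e, G)"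
    if mem: "y \<in> cut_class S (F, e, G)" "x \<in> cut_class S (E, d, F)" for x y
  proof -
    obtain d' e' where x: "x = (E, d', F)" and d': "cut_eq S [] ([E], F) d d'"
      and y: "y = (F, e', G)" and e': "cut_eq S [] ([F], G) e e'"
      using mem unfolding in_cut_class by blast
    show ?thesis
      unfolding x y comp_arrow.simps
      by (rule cut_class_eqI[OF cut_eq_cut_deriv[OF d' e'], symmetric])
  qed
  moreover have "(F, e, G) \<in> cut_class S (F, e, G)" "(E, d, F) \<in> cut_class S (E, d, F)"
    unfolding in_cut_class using d e by (auto intro: cut_eq_refl)
  ultimately have "(\<Union>y \<in> cut_class S (F, e, G). \<Union>x \<in> cut_class S (E, d, F).
      cut_class S (comp_arrow y x)) = cut_class S (E, cut_deriv [E] F G d e, G)"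
    by (intro UN_constant_eqI)
  then show ?thesis by (simp add: Formulae_def)
qed

lemma derives_Phi:
  "derives S [] d ([E], F) \<Longrightarrow>
    derives S [(D @ [X], E)] (cut_deriv (D @ [X]) E F (Hyp 0) d) (D @ [X], F)"
  by (simp add: derives_cut_deriv derives_Hyp derives_weaken_hyps)

lemma is_functor_Phi: "is_functor (Formulae S) (MultiSequents_perm S) (Phi S D X)"
  unfolding is_functor_def
proof (intro conjI allI ballI)
  fix E F f
  assume "f \<in> chom (Formulae S) E F"
  then obtain d where d: "derives S [] d ([E], F)" and f: "f = cut_class S (E, d, F)"
    by (rule chom_cases)
  show "farr (Phi S D X) f \<in> mhom (MultiSequents_perm S) [fobj (Phi S D X) E] (fobj (Phi S D X) F)"
    unfolding f farr_Phi[OF d]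
    using perm_class_mhom[OF derives_Phi[OF d, of D X]] by (simp add: Phi_def)
next
  fix E
  \<comment> \<open>The right unit law is applied with the extra axiom itself as left premise of the
    cut.\<close>
  have "perm_class S (Phi_deriv D X (E, axiom E, E)) = perm_class S ([(D @ [X], E)], Hyp 0, (D @ [X], E))"
    unfolding Phi_deriv.simps
    by (intro perm_class_eqI cut_eq_imp_perm_eq cut_axiom_right derives_Hyp) simp_all
  then show "farr (Phi S D X) (cid (Formulae S) E)
      = mid (MultiSequents_perm S) (fobj (Phi S D X) E)"
    using farr_Phi[OF derives_axiom, of D X E]
    by (simp add: Formulae_def MultiSequents_perm_def Phi_def)
next
  fix E F G f g
  assume "f \<in> chom (Formulae S) E F" "g \<in> chom (Formulae S) F G"
  then obtain d e where d: "derives S [] d ([E], F)" and f: "f = cut_class S (E, d, F)"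
    and e: "derives S [] e ([F], G)" and g: "g = cut_class S (F, e, G)"
    by (meson chom_cases)
  let ?\<Gamma> = "D @ [X]"
  let ?H = "[(?\<Gamma>, E)]"
  have de: "derives S [] (cut_deriv [E] F G d e) ([E], G)"
    using d e by (rule derives_cut_deriv)
  \<comment> \<open>The inner cut replaces the extra axiom of the outer cut. Its own extra axiom
    keeps the number 0, and \<open>d\<close> and \<open>e\<close> are closed.\<close>
  have "mcomp (MultiSequents_perm S) (perm_class S (Phi_deriv D X (F, e, G)))
      [perm_class S (Phi_deriv D X (E, d, F))]
    = perm_class S (?H, cut_deriv ?\<Gamma> F G (cut_deriv ?\<Gamma> E F (Hyp 0) d) e, (?\<Gamma>, G))"
    using mcomp_classes[of "[Phi_deriv D X (E, d, F)]" "cut_deriv ?\<Gamma> F G (Hyp 0) e" "(?\<Gamma>, G)"]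
      derives_Phi[OF e, of D X]
      derives_Phi[OF d, of D X]
    by (simp add: cut_deriv_def subst_closed[OF d] subst_closed[OF e])
  also have "\<dots> = perm_class S (Phi_deriv D X (E, cut_deriv [E] F G d e, G))"
    unfolding Phi_deriv.simps
    by (intro perm_class_eqI switch_imp_perm_eq at_sub.root switch_cut_cut)
      (auto intro!: derives_cut_deriv derives_Hyp derives_weaken_hyps[OF d] derives_weaken_hyps[OF e])
  finally show "farr (Phi S D X) (ccomp (Formulae S) g f)
      = mcomp (MultiSequents_perm S) (farr (Phi S D X) g) [farr (Phi S D X) f]"
    unfolding f g ccomp_classes[OF d e] farr_Phi[OF d] farr_Phi[OF e] farr_Phi[OF de] by simp
qed

section \<open>Naturality of (\<or>L)\<close>

lemma derives_or_left:
  "derives S [(D @ [A], C), (D @ [B], C)] (Infer (OrL A B) [D, []] C [Hyp 0, Hyp 1])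
    (D @ [lor S A B], C)"
  by (intro derives_OrL derives_Hyp) simp_all

lemma naturality:
  assumes p: "derives S [] p ([E], F)"
  shows "mcomp (MultiSequents_perm S) (perm_class S (Phi_deriv D (lor S A B) (E, p, F)))
        [perm_class S (or_left S A B D E)]
      \<in> mhom (MultiSequents_perm S) [(D @ [A], E), (D @ [B], E)] (D @ [lor S A B], F)" (is ?mem)
    and "mcomp (MultiSequents_perm S) (perm_class S (Phi_deriv D (lor S A B) (E, p, F)))
        [perm_class S (or_left S A B D E)]
      = mcomp (MultiSequents_perm S) (perm_class S (or_left S A B D F))
        [perm_class S (Phi_deriv D A (E, p, F)), perm_class S (Phi_deriv D B (E, p, F))]" (is ?eq)
proof -
  let ?H = "[(D @ [A], E), (D @ [B], E)]"
  \<comment> \<open>Explicit representatives of the two composites, one switch apart.\<close>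
  let ?l = "cut_deriv (D @ [lor S A B]) E F (Infer (OrL A B) [D, []] E [Hyp 0, Hyp 1]) p"
  let ?r = "Infer (OrL A B) [D, []] F
    [cut_deriv (D @ [A]) E F (Hyp 0) p, cut_deriv (D @ [B]) E F (Hyp 1) p]"
  have l: "derives S ?H ?l (D @ [lor S A B], F)"
    by (intro derives_cut_deriv derives_or_left derives_weaken_hyps[OF p])
  have r: "derives S ?H ?r (D @ [lor S A B], F)"
    by (intro derives_OrL derives_cut_deriv derives_Hyp derives_weaken_hyps[OF p]) simp_all
  have L: "mcomp (MultiSequents_perm S) (perm_class S (Phi_deriv D (lor S A B) (E, p, F)))
        [perm_class S (or_left S A B D E)] = perm_class S (?H, ?l, (D @ [lor S A B], F))"
    using mcomp_classes[of "[or_left S A B D E]"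
        "cut_deriv (D @ [lor S A B]) E F (Hyp 0) p" "(D @ [lor S A B], F)"] derives_Phi[OF p, of D "lor S A B"]
      derives_or_left[of D A E B]
    by (simp add: or_left_def cut_deriv_def subst_closed[OF p])
  \<comment> \<open>The extra axiom \<open>Hyp 0\<close> of the second component becomes
    \<open>Hyp 1\<close>, as the first component contributes one extra axiom.\<close>
  have R: "mcomp (MultiSequents_perm S) (perm_class S (or_left S A B D F))
        [perm_class S (Phi_deriv D A (E, p, F)), perm_class S (Phi_deriv D B (E, p, F))]
      = perm_class S (?H, ?r, (D @ [lor S A B], F))"
    using mcomp_classes[of "[Phi_deriv D A (E, p, F), Phi_deriv D B (E, p, F)]"
        "Infer (OrL A B) [D, []] F [Hyp 0, Hyp 1]" "(D @ [lor S A B], F)"]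
      derives_Phi[OF p, of D A] derives_Phi[OF p, of D B] derives_or_left[of D A F B]
    by (simp add: or_left_def cut_deriv_def subst_closed[OF p])
  show ?mem unfolding L by (rule perm_class_mhom[OF l])
  show ?eq unfolding L R
    by (intro perm_class_eqI switch_imp_perm_eq l r at_sub.root switch_cut_OrL)
qed

end

theorem proposition2:
  fixes S :: "('f, 'r) calculus" and A B :: 'f and D :: "'f list"
  assumes "sequent_calculus S"
  shows "(\<forall>E F \<Pi>. derives S [] \<Pi> ([E], F) \<longrightarrow>
            mcomp (MultiSequents_perm S)
                (perm_class S (Phi_deriv D (lor S A B) (E, \<Pi>, F)))
                [perm_class S (or_left S A B D E)]
              \<in> mhom (MultiSequents_perm S)
                  [(D @ [A], E), (D @ [B], E)] (D @ [lor S A B], F) \<and>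
            mcomp (MultiSequents_perm S)
                (perm_class S (Phi_deriv D (lor S A B) (E, \<Pi>, F)))
                [perm_class S (or_left S A B D E)]
            = mcomp (MultiSequents_perm S)
                (perm_class S (or_left S A B D F))
                [perm_class S (Phi_deriv D A (E, \<Pi>, F)),
                 perm_class S (Phi_deriv D B (E, \<Pi>, F))])
       \<and> natural_transformation (Formulae S) (MultiSequents_perm S)
            [Phi S D A, Phi S D B] (Phi S D (lor S A B))
            (\<lambda>C. perm_class S (or_left S A B D C))"
proof -
  interpret sequent_calculus S by fact
  have mem: "perm_class S (or_left S A B D C) \<in> mhom (MultiSequents_perm S)
      (map (\<lambda>F. fobj F C) [Phi S D A, Phi S D B]) (fobj (Phi S D (lor S A B)) C)" for C
    using perm_class_mhom[OF derives_or_left] by (simp add: or_left_def Phi_def)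
  have nat: "mcomp (MultiSequents_perm S) (perm_class S (or_left S A B D F))
        (map (\<lambda>G. farr G f) [Phi S D A, Phi S D B])
      = mcomp (MultiSequents_perm S) (farr (Phi S D (lor S A B)) f)
        [perm_class S (or_left S A B D E)]"
    if f: "f \<in> chom (Formulae S) E F" for E F f
  proof -
    \<comment> \<open>An arrow of \<open>Formulae\<close> is the class of a closed derivation, so
      the equation for derivations gives naturality on classes.\<close>
    obtain d where d: "derives S [] d ([E], F)" and f_eq: "f = cut_class S (E, d, F)"
      using f by (rule chom_cases)
    show ?thesis
      unfolding f_eq list.map farr_Phi[OF d] by (rule naturality(2)[OF d, symmetric])
  qed
  have "natural_transformation (Formulae S) (MultiSequents_perm S)
      [Phi S D A, Phi S D B] (Phi S D (lor S A B)) (\<lambda>C. perm_class S (or_left S A B D C))"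
    \<comment> \<open>Keeping \<open>list.map\<close> folded leaves the goals in the form of
      \<open>mem\<close> and \<open>nat\<close>.\<close>
    unfolding natural_transformation_def using mem nat is_functor_Phi by (auto simp del: list.map)
  then show ?thesis using naturality by blast
qed

end
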